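(* Let $X$ be a non-trivial complex Banach space, let $I=\mathbb{R}$ or $I=[0,\infty)$, and let $\omega\in I$, $\omega\neq 0$. Then $SAP_\omega(I:X)\subseteq Q\text{-}AAP(I:X)$.
   Context: $SAP_\omega(I:X)$ (S-asymptotically $\omega$-periodic functions) is the set of bounded continuous functions $f:I\to X$ such that $\lim_{|t|\to\infty}\|f(t+\omega)-f(t)\|=0$. $Q\text{-}AAP(I:X)$ (quasi-asymptotically almost periodic functions) is the set of bounded continuous $f:I\to X$ such that for each $\epsilon>0$ there exists a finite number $L(\epsilon)>0$ such that any interval $I'\subseteq I$ of length $L(\epsilon)$ contains at least one number $\tau\in I'$ for which there exists a finite number $M(\epsilon,\tau)>0$ with $\|f(t+\tau)-f(t)\|\le\epsilon$ for all $t\in I$ with $|t|\ge M(\epsilon,\tau)$. *)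

theory Defs
  imports "HOL-Analysis.Analysis"
begin

text \<open>
  The distribution only has real Banach spaces. A complex Banach space is a real one with a
  compatible complex scalar multiplication for which the norm is absolutely homogeneous.
\<close>

class complex_banach = banach +
  fixes scaleC :: "complex \<Rightarrow> 'a \<Rightarrow> 'a"  (infixr \<open>*\<^sub>C\<close> 75)
  assumes scaleC_add_right: "a *\<^sub>C (x + y) = a *\<^sub>C x + a *\<^sub>C y"
    and scaleC_add_left: "(a + b) *\<^sub>C x = a *\<^sub>C x + b *\<^sub>C x"
    and scaleC_scaleC: "a *\<^sub>C b *\<^sub>C x = (a * b) *\<^sub>C x"
    and scaleC_of_real: "complex_of_real r *\<^sub>C x = r *\<^sub>R x"
    and norm_scaleC: "norm (a *\<^sub>C x) = cmod a * norm x"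

instantiation complex :: complex_banach
begin

definition scaleC_complex :: "complex \<Rightarrow> complex \<Rightarrow> complex"
  where "scaleC_complex a x = a * x"

instance
  by standard (simp_all add: scaleC_complex_def algebra_simps scaleR_conv_of_real norm_mult)

end

text \<open>
  Functions \<open>I \<rightarrow> X\<close> are represented by total functions on the reals of which only the values
  on \<open>I\<close> matter; \<open>I\<close> is meant to be the real line or \<open>{0..}\<close>, and \<open>\<omega> \<in> I\<close>,
  so that \<open>t + \<omega> \<in> I\<close> for all \<open>t \<in> I\<close>.
\<close>

definition bounded_continuous_on :: "real set \<Rightarrow> (real \<Rightarrow> 'a::real_normed_vector) set"
  where "bounded_continuous_on I = {f. continuous_on I f \<and> bounded (f ` I)}"

text \<open>
  On the reals, \<open>at_infinity\<close> is the filter of \<open>|t| \<rightarrow> \<infinity>\<close>; it is restricted to \<open>t \<in> I\<close>.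
\<close>

definition SAP :: "real \<Rightarrow> real set \<Rightarrow> (real \<Rightarrow> 'a::real_normed_vector) set"
  where "SAP \<omega> I = {f \<in> bounded_continuous_on I.
    ((\<lambda>t. norm (f (t + \<omega>) - f t)) \<longlongrightarrow> 0) (inf at_infinity (principal I))}"

text \<open>
  The intervals \<open>J\<close> may be open, closed or half-open; the length of a bounded interval is its
  diameter. Boundedness is required explicitly because \<open>diameter\<close> is not meaningful on
  unbounded sets.
\<close>

definition Q_AAP :: "real set \<Rightarrow> (real \<Rightarrow> 'a::real_normed_vector) set"
  where "Q_AAP I = {f \<in> bounded_continuous_on I.
    \<forall>\<epsilon>>0. \<exists>L>0. \<forall>J. is_interval J \<and> bounded J \<and> diameter J = L \<and> J \<subseteq> I \<longrightarrow>
      (\<exists>\<tau>\<in>J. \<exists>M>0. \<forall>t\<in>I. \<bar>t\<bar> \<ge> M \<longrightarrow> norm (f (t + \<tau>) - f t) \<le> \<epsilon>)}"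

end

theory Submission
  imports Defs
begin

text \<open>
  Asymptotic periods are stable under addition (and under negation on the whole line), so every
  multiple \<open>k * \<omega>\<close> that lies in \<open>I\<close> is again one. A multiple of \<open>\<omega>\<close> is found in any interval
  of length \<open>2 * \<bar>\<omega>\<bar>\<close>; the factor 2 makes room for intervals that do not contain their endpoints.
\<close>

text \<open>Adding a constant to an argument of unbounded norm leaves the norm unbounded. This
  justifies replacing \<open>t\<close> by \<open>t + c\<close> in limits along
  \<open>I\<close>.\<close>

lemma filterlim_add_const_at_infinity_principal:
  fixes c :: "'a::real_normed_vector"
  assumes "\<And>t. t \<in> I \<Longrightarrow> t + c \<in> I"
  shows "filterlim (\<lambda>t. t + c) (inf at_infinity (principal I)) (inf at_infinity (principal I))"
proof -
  have "filterlim (\<lambda>t. t + c) at_infinity (inf at_infinity (principal I))"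
    by (rule tendsto_add_filterlim_at_infinity'[OF _ tendsto_const])
       (simp add: filterlim_def)
  moreover have "\<forall>\<^sub>F t in inf at_infinity (principal I). t + c \<in> I"
    by (simp add: eventually_inf_principal assms)
  ultimately show ?thesis
    by (simp add: filterlim_inf filterlim_principal)
qed

text \<open>The difference is used without its norm, so that limits can be added and negated
  directly.\<close>

definition asymptotic_period ::
    "'a::real_normed_vector set \<Rightarrow> ('a \<Rightarrow> 'b::real_normed_vector) \<Rightarrow> 'a \<Rightarrow> bool"
  where "asymptotic_period I f c \<longleftrightarrow>
    ((\<lambda>t. f (t + c) - f t) \<longlongrightarrow> 0) (inf at_infinity (principal I))"

text \<open>Telescoping through \<open>f (t + c)\<close>: the limit for \<open>d\<close> is taken
  along the shifted argument \<open>t + c\<close>, so only the shift by \<open>c\<close> has to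
  preserve \<open>I\<close>.\<close>

lemma asymptotic_period_add:
  assumes "asymptotic_period I f c" "asymptotic_period I f d"
    and "\<And>t. t \<in> I \<Longrightarrow> t + c \<in> I"
  shows "asymptotic_period I f (c + d)"
proof -
  have "((\<lambda>t. f (t + c + d) - f (t + c)) \<longlongrightarrow> 0) (inf at_infinity (principal I))"
    using filterlim_compose[OF assms(2)[unfolded asymptotic_period_def]
        filterlim_add_const_at_infinity_principal[OF assms(3)]] .
  from tendsto_add[OF this assms(1)[unfolded asymptotic_period_def]] show ?thesis
    by (simp add: asymptotic_period_def add.assoc)
qed

text \<open>Substituting \<open>t - c\<close> for \<open>t\<close> turns the difference for
  \<open>c\<close> into \<open>f t - f (t - c)\<close>, whose negative is the difference for
  \<open>- c\<close>.\<close>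

lemma asymptotic_period_minus:
  assumes "asymptotic_period I f c" and "\<And>t. t \<in> I \<Longrightarrow> t - c \<in> I"
  shows "asymptotic_period I f (- c)"
proof -
  have "filterlim (\<lambda>t. t + - c) (inf at_infinity (principal I)) (inf at_infinity (principal I))"
    by (rule filterlim_add_const_at_infinity_principal) (simp add: assms(2))
  from tendsto_minus[OF filterlim_compose[OF assms(1)[unfolded asymptotic_period_def] this]]
  show ?thesis
    by (simp add: asymptotic_period_def)
qed

lemma asymptotic_period_of_nat_mult:
  fixes c :: real
  assumes "asymptotic_period I f c" and "\<And>t. t \<in> I \<Longrightarrow> t + c \<in> I"
  shows "asymptotic_period I f (of_nat n * c)"
proof (induction n)
  case 0
  show ?case by (simp add: asymptotic_period_def)
next
  case (Suc n)
  \<comment> \<open>The single \<open>c\<close> is the first summand, so closure of \<open>I\<close>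
    under one shift suffices.\<close>
  from asymptotic_period_add[OF assms(1) Suc assms(2)] show ?case
    by (simp add: algebra_simps)
qed

text \<open>On the half-line \<open>c\<close> is positive, so a multiple lying in \<open>I\<close>
  has \<open>k \<ge> 0\<close>. Negative \<open>k\<close> thus occurs only on the whole line, where
  shifting by \<open>- c\<close> is harmless.\<close>

lemma asymptotic_period_of_int_mult:
  fixes c :: real
  assumes "asymptotic_period I f c" and I: "I = UNIV \<or> I = {0..}"
    and "c \<in> I" and "c \<noteq> 0" and "of_int k * c \<in> I"
  shows "asymptotic_period I f (of_int k * c)"
proof (cases "k \<ge> 0")
  case True
  then show ?thesis
    using asymptotic_period_of_nat_mult[OF assms(1), of "nat k"] I \<open>c \<in> I\<close> by auto
next
  case False
  with I \<open>c \<in> I\<close> \<open>c \<noteq> 0\<close> \<open>of_int k * c \<in> I\<close> have "I = UNIV"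
    by (auto simp: zero_le_mult_iff)
  then show ?thesis
    using asymptotic_period_of_nat_mult[OF asymptotic_period_minus[OF assms(1)], of "nat (- k)"]
      False by simp
qed

lemma asymptotic_period_imp_norm_le:
  assumes "asymptotic_period I f c" "\<epsilon> > 0"
  shows "\<exists>M>0. \<forall>t\<in>I. norm t \<ge> M \<longrightarrow> norm (f (t + c) - f t) \<le> \<epsilon>"
proof -
  have "\<forall>\<^sub>F t in inf at_infinity (principal I). norm (f (t + c) - f t) < \<epsilon>"
    using tendstoD[OF assms(1)[unfolded asymptotic_period_def] assms(2)] by simp
  then show ?thesis
    unfolding eventually_inf_principal eventually_at_infinity_pos
    by (meson less_imp_le)
qed

text \<open>Two points \<open>x\<close> and \<open>y\<close> of \<open>J\<close> are more than
  \<open>\<bar>c\<bar>\<close> apart, and the least multiple of \<open>\<bar>c\<bar>\<close> not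
  below \<open>x\<close> exceeds \<open>x\<close> by at most \<open>\<bar>c\<bar>\<close>, so it
  lies between them.\<close>

lemma interval_contains_int_multiple:
  fixes c :: real
  assumes "is_interval J" "bounded J" "diameter J > \<bar>c\<bar>" "c \<noteq> 0"
  shows "\<exists>k::int. of_int k * c \<in> J"
proof -
  \<comment> \<open>The diameter is a supremum that may not be attained; the strict bound on it
    still yields such a pair, ordered here so that \<open>x < y\<close>.\<close>
  obtain x y where xy: "x \<in> J" "y \<in> J" "\<bar>c\<bar> < y - x"
    using diameter_lower_bounded[OF assms(2), of "\<bar>c\<bar>"] assms(3,4)
    by (fastforce simp: dist_real_def abs_if split: if_splits)
  have "of_int \<lceil>x / \<bar>c\<bar>\<rceil> * \<bar>c\<bar> \<in> J"
  proof (rule mem_is_interval_1_I[OF assms(1) xy(1,2)])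
    show "x \<le> of_int \<lceil>x / \<bar>c\<bar>\<rceil> * \<bar>c\<bar>"
      using assms(4) le_of_int_ceiling[of "x / \<bar>c\<bar>"] by (simp add: pos_divide_le_eq del: le_of_int_ceiling)
    have "of_int \<lceil>x / \<bar>c\<bar>\<rceil> * \<bar>c\<bar> \<le> (x / \<bar>c\<bar> + 1) * \<bar>c\<bar>"
      by (intro mult_right_mono of_int_ceiling_le_add_one) auto
    also have "\<dots> \<le> y"
      using assms(4) xy(3) by (simp add: distrib_right)
    finally show "of_int \<lceil>x / \<bar>c\<bar>\<rceil> * \<bar>c\<bar> \<le> y" .
  qed
  \<comment> \<open>The sign of \<open>c\<close> is absorbed into the integer coefficient.\<close>
  moreover have "of_int \<lceil>x / \<bar>c\<bar>\<rceil> * \<bar>c\<bar> = of_int (\<lceil>x / \<bar>c\<bar>\<rceil> * (if c < 0 then - 1 else 1)) * c"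
    by simp
  ultimately show ?thesis by metis
qed

theorem proposition2p7:
  fixes I :: "real set" and \<omega> :: real
  assumes "\<exists>x::'a::complex_banach. x \<noteq> 0"
    and "I = UNIV \<or> I = {0..}"
    and "\<omega> \<in> I" and "\<omega> \<noteq> 0"
  shows "(SAP \<omega> I :: (real \<Rightarrow> 'a) set) \<subseteq> Q_AAP I"
proof
  fix f :: "real \<Rightarrow> 'a"
  assume "f \<in> SAP \<omega> I"
  then have f: "f \<in> bounded_continuous_on I" and period: "asymptotic_period I f \<omega>"
    by (auto simp: SAP_def asymptotic_period_def tendsto_norm_zero_iff)
  \<comment> \<open>The same length \<open>2 * \<bar>\<omega>\<bar>\<close> serves every
    \<open>\<epsilon>\<close>, and \<tau> is a multiple of \<omega> found from \<open>J\<close>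
    alone; only \<open>M\<close> is chosen according to \<open>\<epsilon>\<close>.\<close>
  have "\<exists>\<tau>\<in>J. \<exists>M>0. \<forall>t\<in>I. \<bar>t\<bar> \<ge> M \<longrightarrow> norm (f (t + \<tau>) - f t) \<le> \<epsilon>"
    if "\<epsilon> > 0" and J: "is_interval J" "bounded J" "diameter J = 2 * \<bar>\<omega>\<bar>" "J \<subseteq> I" for \<epsilon> J
  proof -
    obtain k :: int where k: "of_int k * \<omega> \<in> J"
      using interval_contains_int_multiple[of J \<omega>] J assms(4) by auto
    then have "asymptotic_period I f (of_int k * \<omega>)"
      using asymptotic_period_of_int_mult[OF period assms(2-4)] J(4) by blast
    from asymptotic_period_imp_norm_le[OF this \<open>\<epsilon> > 0\<close>] show ?thesis
      using k by auto
  qed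
  moreover have "2 * \<bar>\<omega>\<bar> > 0"
    using assms(4) by simp
  ultimately show "f \<in> Q_AAP I"
    unfolding Q_AAP_def using f by blast
qed

end
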